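(* Let $C(x)$ and $B(x)$ be the generating functions of the Catalan numbers and of the central binomial coefficients, respectively. Then the following inversions hold in the Riordan group: (1) $\left(C,xC^2\right)^{-1}=\left(\frac{1}{1+x},\frac{x}{(1+x)^2}\right)$; (2) $\left(C^2,xC^2\right)^{-1}=\left(\frac{1}{(1+x)^2},\frac{x}{(1+x)^2}\right)$; (3) $\left(B,xC^2\right)^{-1}=\left(\frac{1-x}{1+x},\frac{x}{(1+x)^2}\right)$; (4) $\left(BC,xC^2\right)^{-1}=\left(\frac{1-x}{(1+x)^2},\frac{x}{(1+x)^2}\right)$.
   Context: $C(x)=\sum_{n\geq 0}\frac{1}{n+1}\binom{2n}{n}x^n$ and $B(x)=\sum_{n\geq 0}\binom{2n}{n}x^n$, regarded as formal power series over $\mathbb{R}$. Let $\mathbb{R}[[x]]^{\times}$ denote the set of multiplicatively invertible formal power series. The Riordan group is the set $\mathbb{R}[[x]]^{\times}\times x\,\mathbb{R}[[x]]^{\times}$ with the product $(g_1,f_1)*(g_2,f_2)=\left(g_1\cdot(g_2\circ f_1),\,f_2\circ f_1\right)$ and identity $(1,x)$. The inverse of $(g,f)$ is $\left(\frac{1}{g\circ\overline{f}},\overline{f}\right)$, where $\overline{f}$ is the compositional inverse of $f$. A pair $(g,f)$ is identified with the infinite lower triangular matrix (Riordan array) with entries $a_{nk}=[x^n]\,g(x)f(x)^k$, $n,k\geq 0$; under this identification the product of pairs corresponds to the matrix product. *)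

theory Defs
  imports "HOL-Algebra.Group" "HOL-Computational_Algebra.Formal_Power_Series"
begin

unbundle fps_syntax

definition catalan_fps :: "real fps" where
  "catalan_fps = Abs_fps (\<lambda>n. 1 / real (n + 1) * real ((2 * n) choose n))"

definition central_binomial_fps :: "real fps" where
  "central_binomial_fps = Abs_fps (\<lambda>n. real ((2 * n) choose n))"

definition riordan_group :: "(real fps \<times> real fps) monoid" where
  "riordan_group =
    \<lparr>carrier = {g. g dvd 1} \<times> {fps_X * h | h. h dvd 1},
     monoid.mult = (\<lambda>(g\<^sub>1, f\<^sub>1) (g\<^sub>2, f\<^sub>2). (g\<^sub>1 * (g\<^sub>2 oo f\<^sub>1), f\<^sub>2 oo f\<^sub>1)),
     one = (1, fps_X)\<rparr>"

lemma riordan_carrier_iff: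
  "(g, f) \<in> carrier riordan_group \<longleftrightarrow> g $ 0 \<noteq> 0 \<and> f $ 0 = 0 \<and> f $ 1 \<noteq> 0"
proof -
  have "(\<exists>h. f = fps_X * h \<and> h $ 0 \<noteq> 0) \<longleftrightarrow> f $ 0 = 0 \<and> f $ 1 \<noteq> 0"
  proof
    assume f: "f $ 0 = 0 \<and> f $ 1 \<noteq> 0"
    have "f = fps_X * fps_shift 1 f"
      by (rule fps_ext) (use f in \<open>auto simp: fps_X_mult_nth\<close>)
    moreover have "fps_shift 1 f $ 0 \<noteq> 0" using f by simp
    ultimately show "\<exists>h. f = fps_X * h \<and> h $ 0 \<noteq> 0" by blast
  qed auto
  then show ?thesis
    by (auto simp: riordan_group_def fps_is_unit_iff)
qed

lemma riordan_group_is_group: "group riordan_group"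
proof (rule groupI)
  fix p q assume "p \<in> carrier riordan_group" "q \<in> carrier riordan_group"
  moreover obtain g f where p: "p = (g, f)" by (cases p)
  moreover obtain g' f' where q: "q = (g', f')" by (cases q)
  ultimately have c: "g $ 0 \<noteq> 0" "f $ 0 = 0" "f $ 1 \<noteq> 0" "g' $ 0 \<noteq> 0" "f' $ 0 = 0" "f' $ 1 \<noteq> 0"
    by (auto simp: riordan_carrier_iff)
  have "p \<otimes>\<^bsub>riordan_group\<^esub> q = (g * (g' oo f), f' oo f)"
    by (simp add: p q riordan_group_def)
  moreover have "(f' oo f) $ 1 = f' $ 1 * f $ 1"
    using c by (simp add: fps_compose_nth)
  ultimately show "p \<otimes>\<^bsub>riordan_group\<^esub> q \<in> carrier riordan_group"
    using c by (simp add: riordan_carrier_iff)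
next
  have "\<one>\<^bsub>riordan_group\<^esub> = (1, fps_X)" by (simp add: riordan_group_def)
  then show "\<one>\<^bsub>riordan_group\<^esub> \<in> carrier riordan_group"
    by (simp add: riordan_carrier_iff)
next
  fix p q r
  assume "p \<in> carrier riordan_group" "q \<in> carrier riordan_group" "r \<in> carrier riordan_group"
  moreover obtain g f where p: "p = (g, f)" by (cases p)
  moreover obtain g' f' where q: "q = (g', f')" by (cases q)
  moreover obtain g'' f'' where r: "r = (g'', f'')" by (cases r)
  ultimately have c: "f $ 0 = 0" "f' $ 0 = 0" "f'' $ 0 = 0"
    by (auto simp: riordan_carrier_iff)
  show "p \<otimes>\<^bsub>riordan_group\<^esub> q \<otimes>\<^bsub>riordan_group\<^esub> r = p \<otimes>\<^bsub>riordan_group\<^esub> (q \<otimes>\<^bsub>riordan_group\<^esub> r)"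
    using c by (simp add: p q r riordan_group_def fps_compose_mult_distrib fps_compose_assoc mult.assoc)
next
  fix p assume "p \<in> carrier riordan_group"
  moreover obtain g f where p: "p = (g, f)" by (cases p)
  ultimately have c: "f $ 0 = 0" by (auto simp: riordan_carrier_iff)
  then show "\<one>\<^bsub>riordan_group\<^esub> \<otimes>\<^bsub>riordan_group\<^esub> p = p"
    by (simp add: p riordan_group_def)
next
  fix p assume "p \<in> carrier riordan_group"
  moreover obtain g f where p: "p = (g, f)" by (cases p)
  ultimately have c: "g $ 0 \<noteq> 0" "f $ 0 = 0" "f $ 1 \<noteq> 0" by (auto simp: riordan_carrier_iff)
  define q where "q = (inverse (g oo fps_inv f), fps_inv f)"
  have z: "fps_inv f $ 0 = 0" by (simp add: fps_inv_def)
  have "fps_inv f $ 1 \<noteq> 0" using c by (simp add: fps_inv_def)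
  then have "q \<in> carrier riordan_group" using c z by (simp add: q_def riordan_carrier_iff)
  moreover have "q \<otimes>\<^bsub>riordan_group\<^esub> p = \<one>\<^bsub>riordan_group\<^esub>"
    using c z by (simp add: p q_def riordan_group_def fps_inv_right inverse_mult_eq_1)
  ultimately show "\<exists>q \<in> carrier riordan_group. q \<otimes>\<^bsub>riordan_group\<^esub> p = \<one>\<^bsub>riordan_group\<^esub>" by blast
qed

text \<open>
  The library's group inverse is a definite description, meaningful only on the carrier;
  the four arrays inverted below all lie in it.
\<close>

lemma catalan_arrays_in_riordan_group:
  "(catalan_fps, fps_X * catalan_fps ^ 2) \<in> carrier riordan_group"
  "(catalan_fps ^ 2, fps_X * catalan_fps ^ 2) \<in> carrier riordan_group"
  "(central_binomial_fps, fps_X * catalan_fps ^ 2) \<in> carrier riordan_group"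
  "(central_binomial_fps * catalan_fps, fps_X * catalan_fps ^ 2) \<in> carrier riordan_group"
  by (simp_all add: riordan_carrier_iff catalan_fps_def central_binomial_fps_def)

end

theory Submission
  imports Defs
begin

text \<open>
  Write \<open>C\<close> and \<open>B\<close> for the two series. The ratio of consecutive central binomial coefficients
  says \<open>(1 - 4x) B' = 2 B\<close>, so \<open>(1 - 4x) B\<^sup>2\<close> has derivative zero and equals \<open>1\<close>; the same
  ratio says \<open>(1 - 4x) B = 1 - 2 x C\<close>. Squaring the latter relation and cancelling \<open>4 x\<close> gives
  \<open>C = 1 + x C\<^sup>2\<close>, and then \<open>B (1 - 2 x C) = 1\<close> becomes \<open>B (2 - C) = C\<close>.

  Hence substituting \<open>x C\<^sup>2 = C - 1\<close> for \<open>x\<close> turns \<open>1 + x\<close> into \<open>C\<close> and \<open>1 - x\<close> into \<open>2 - C\<close>.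
  It sends \<open>x / (1 + x)\<^sup>2\<close> to \<open>x C\<^sup>2 / C\<^sup>2 = x\<close> and the four claimed first components to
  \<open>1/C\<close>, \<open>1/C\<^sup>2\<close>, \<open>(2 - C)/C = 1/B\<close> and \<open>(2 - C)/C\<^sup>2 = 1/(B C)\<close>, so each claimed inverse is a
  right inverse in the Riordan group.
\<close>

lemma Suc_times_central_binomial:
  "Suc n * ((2 * Suc n) choose Suc n) = 2 * (2 * n + 1) * ((2 * n) choose n)"
proof -
  have "Suc n * (Suc (Suc (2 * n)) choose Suc n) = Suc (Suc (2 * n)) * (Suc (2 * n) choose n)"
    by (rule Suc_times_binomial)
  moreover have "Suc n * (Suc (2 * n) choose n) = Suc (2 * n) * ((2 * n) choose n)"
    using binomial_absorb_comp [of "Suc (2 * n)" n] by (simp add: Suc_diff_le)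
  ultimately show ?thesis
    by simp
qed

lemma central_binomial_fps_nth_Suc:
  "real (Suc n) * central_binomial_fps $ Suc n = 2 * (2 * real n + 1) * central_binomial_fps $ n"
proof -
  have "real (Suc n * ((2 * Suc n) choose Suc n)) = real (2 * (2 * n + 1) * ((2 * n) choose n))"
    by (simp only: Suc_times_central_binomial)
  then show ?thesis
    by (simp add: central_binomial_fps_def algebra_simps)
qed

lemma catalan_fps_nth: "real (Suc n) * catalan_fps $ n = central_binomial_fps $ n"
  by (simp add: catalan_fps_def central_binomial_fps_def)

lemma catalan_fps_nth_0 [simp]: "catalan_fps $ 0 = 1"
  by (simp add: catalan_fps_def)

lemma central_binomial_fps_nth_0 [simp]: "central_binomial_fps $ 0 = 1"
  by (simp add: central_binomial_fps_def)

lemma central_binomial_fps_square: "(1 - 4 * fps_X) * central_binomial_fps ^ 2 = 1"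
proof -
  let ?B = central_binomial_fps
  have ode: "(1 - 4 * fps_X) * fps_deriv ?B = 2 * ?B"
  proof (rule fps_ext)
    fix n
    show "((1 - 4 * fps_X) * fps_deriv ?B) $ n = (2 * ?B) $ n"
      using central_binomial_fps_nth_Suc [of n]
      by (cases n) (auto simp: algebra_simps fps_numeral_fps_const)
  qed
  have "fps_deriv ((1 - 4 * fps_X) * ?B ^ 2)
      = 2 * ?B * ((1 - 4 * fps_X) * fps_deriv ?B) - 4 * ?B ^ 2"
    by (simp add: fps_deriv_power fps_numeral_fps_const algebra_simps power2_eq_square)
  also have "\<dots> = 0"
    unfolding ode by (simp add: power2_eq_square)
  finally have "(1 - 4 * fps_X) * ?B ^ 2 = fps_const (((1 - 4 * fps_X) * ?B ^ 2) $ 0)"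
    by (simp only: fps_deriv_eq_0_iff)
  then show ?thesis
    by (simp add: fps_nth_power_0)
qed

lemma central_binomial_fps_conv_catalan:
  "(1 - 4 * fps_X) * central_binomial_fps = 1 - 2 * fps_X * catalan_fps"
proof (rule fps_ext)
  fix n
  show "((1 - 4 * fps_X) * central_binomial_fps) $ n = (1 - 2 * fps_X * catalan_fps) $ n"
  proof (cases n)
    case 0
    then show ?thesis by (simp add: fps_numeral_fps_const)
  next
    case (Suc m)
    have "real (Suc m) * (central_binomial_fps $ Suc m - 4 * central_binomial_fps $ m)
        = real (Suc m) * (- 2 * catalan_fps $ m)"
      using central_binomial_fps_nth_Suc [of m] catalan_fps_nth [of m]
      by (simp add: algebra_simps)
    then have "central_binomial_fps $ Suc m - 4 * central_binomial_fps $ m = - 2 * catalan_fps $ m"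
      by (simp only: mult_cancel_left) simp
    then show ?thesis
      using Suc by (simp add: left_diff_distrib mult.assoc fps_numeral_fps_const)
  qed
qed

lemma catalan_fps_functional_equation: "catalan_fps = 1 + fps_X * catalan_fps ^ 2"
proof -
  let ?B = central_binomial_fps and ?C = catalan_fps
  have "(1 - 2 * fps_X * ?C) ^ 2 = ((1 - 4 * fps_X) * ?B) ^ 2"
    by (simp only: central_binomial_fps_conv_catalan)
  also have "\<dots> = (1 - 4 * fps_X) * ((1 - 4 * fps_X) * ?B ^ 2)"
    by (simp only: power2_eq_square ac_simps)
  finally have "(1 - 2 * fps_X * ?C) ^ 2 = 1 - 4 * fps_X"
    by (simp add: central_binomial_fps_square)
  then have "4 * fps_X * ?C = 4 * fps_X * (1 + fps_X * ?C ^ 2)"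
    by (simp add: power2_eq_square algebra_simps)
  then show ?thesis
    by simp
qed

lemma central_binomial_fps_times_catalan: "central_binomial_fps * (2 - catalan_fps) = catalan_fps"
proof -
  let ?B = central_binomial_fps and ?C = catalan_fps
  have "(1 - 2 * fps_X * ?C) * ?C = ?C - 2 * (fps_X * ?C ^ 2)"
    by (simp add: power2_eq_square algebra_simps)
  also have "fps_X * ?C ^ 2 = ?C - 1"
    using catalan_fps_functional_equation by (simp add: algebra_simps)
  finally have "2 - ?C = (1 - 4 * fps_X) * ?B * ?C"
    by (simp add: central_binomial_fps_conv_catalan)
  then have "?B * (2 - ?C) = ((1 - 4 * fps_X) * ?B ^ 2) * ?C"
    by (simp add: power2_eq_square ac_simps)
  then show ?thesis
    by (simp add: central_binomial_fps_square)
qed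

lemma fps_compose_one_plus_X_catalan: "(1 + fps_X) oo (fps_X * catalan_fps ^ 2) = catalan_fps"
  using catalan_fps_functional_equation by (simp add: fps_compose_add_distrib)

lemma fps_compose_one_minus_X_catalan: "(1 - fps_X) oo (fps_X * catalan_fps ^ 2) = 2 - catalan_fps"
  using catalan_fps_functional_equation by (simp add: fps_compose_sub_distrib algebra_simps)

lemma fps_compose_divide_power_one_plus_X_catalan:
  "(h / (1 + fps_X) ^ k) oo (fps_X * catalan_fps ^ 2)
     = (h oo (fps_X * catalan_fps ^ 2)) / catalan_fps ^ k"
  by (simp add: fps_divide_compose fps_compose_power [symmetric] fps_compose_one_plus_X_catalan)

text \<open>
  The second component of the inverse is the same in all four cases, so only the first components
  remain to be matched. The hypothesis on \<open>p\<close> makes the claimed pair a right inverse, which in a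
  group suffices.
\<close>

lemma riordan_inv_catalan_square:
  assumes "(g, fps_X * catalan_fps ^ 2) \<in> carrier riordan_group"
    and inverse: "g * (p oo (fps_X * catalan_fps ^ 2)) = 1"
  shows "inv\<^bsub>riordan_group\<^esub> (g, fps_X * catalan_fps ^ 2) = (p, fps_X / (1 + fps_X) ^ 2)"
proof -
  interpret group riordan_group
    by (rule riordan_group_is_group)
  let ?u = "(g, fps_X * catalan_fps ^ 2)" and ?v = "(p, fps_X / (1 + fps_X) ^ 2)"
  have "catalan_fps \<noteq> 0"
    using catalan_fps_nth_0 by force
  then have "(fps_X / (1 + fps_X) ^ 2) oo (fps_X * catalan_fps ^ 2) = fps_X"
    by (simp add: fps_compose_divide_power_one_plus_X_catalan)
  then have right_inv: "?u \<otimes>\<^bsub>riordan_group\<^esub> ?v = \<one>\<^bsub>riordan_group\<^esub>"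
    by (simp add: riordan_group_def inverse)
  have "p $ 0 \<noteq> 0"
    using arg_cong [OF inverse, of "\<lambda>h. h $ 0"] by auto
  then have "?v \<in> carrier riordan_group"
    by (simp add: riordan_carrier_iff fps_divide_unit)
  then show ?thesis
    using assms(1) right_inv by (metis inv_comm inv_equality)
qed

theorem theorem9p3:
  shows "inv\<^bsub>riordan_group\<^esub> (catalan_fps, fps_X * catalan_fps ^ 2)
           = (1 / (1 + fps_X), fps_X / (1 + fps_X) ^ 2)
    \<and> inv\<^bsub>riordan_group\<^esub> (catalan_fps ^ 2, fps_X * catalan_fps ^ 2)
           = (1 / (1 + fps_X) ^ 2, fps_X / (1 + fps_X) ^ 2)
    \<and> inv\<^bsub>riordan_group\<^esub> (central_binomial_fps, fps_X * catalan_fps ^ 2)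
           = ((1 - fps_X) / (1 + fps_X), fps_X / (1 + fps_X) ^ 2)
    \<and> inv\<^bsub>riordan_group\<^esub> (central_binomial_fps * catalan_fps, fps_X * catalan_fps ^ 2)
           = ((1 - fps_X) / (1 + fps_X) ^ 2, fps_X / (1 + fps_X) ^ 2)"
proof -
  let ?B = central_binomial_fps and ?C = catalan_fps
  let ?f = "fps_X * ?C ^ 2"
  note subst_square = fps_compose_divide_power_one_plus_X_catalan [where k = 2]
  note subst_one = fps_compose_divide_power_one_plus_X_catalan [where k = 1, unfolded power_one_right]
  have cancel: "a * (b / ?C ^ k) = 1" if "a * b = ?C ^ k" for a b k
    using that by (simp add: fps_divide_unit mult.assoc [symmetric] inverse_mult_eq_1')
  have "?C * ((1 / (1 + fps_X)) oo ?f) = 1"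
    unfolding subst_one using cancel [of ?C 1 1] by simp
  moreover have "?C ^ 2 * ((1 / (1 + fps_X) ^ 2) oo ?f) = 1"
    unfolding subst_square fps_compose_1 by (rule cancel) simp
  moreover have "?B * (((1 - fps_X) / (1 + fps_X)) oo ?f) = 1"
    unfolding subst_one fps_compose_one_minus_X_catalan
    using cancel [of ?B "2 - ?C" 1] by (simp add: central_binomial_fps_times_catalan)
  moreover have "?B * ?C * (((1 - fps_X) / (1 + fps_X) ^ 2) oo ?f) = 1"
    unfolding subst_square fps_compose_one_minus_X_catalan
  proof (rule cancel)
    have "?B * ?C * (2 - ?C) = ?B * (2 - ?C) * ?C"
      by (simp only: ac_simps)
    then show "?B * ?C * (2 - ?C) = ?C ^ 2"
      by (simp only: central_binomial_fps_times_catalan power2_eq_square)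
  qed
  ultimately show ?thesis
    by (intro conjI riordan_inv_catalan_square catalan_arrays_in_riordan_group)
qed

end
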